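(* Let $k\in\mathbb{N}_0$ and $n\in\mathbb{N}_0$. Then \[ n\, t_k(n) = k \sum_{j=0}^{n-1} t_k (j) \left( \sigma(n-j)- 4 \sigma\!\left(\tfrac{n-j}{2}\right) \right). \]
   Context: For $k\in\mathbb{N}_0$ and $n\in\mathbb{N}_0$, $t_k(n)=\#\{(x_1,\dots,x_k)\in\mathbb{N}_0^k : n=\sum_{i=1}^k \frac{x_i(x_i+1)}{2}\}$, where $\mathbb{N}_0=\{0,1,2,\dots\}$ (so $t_k(0)=1$). The function $\sigma$ is defined on $\mathbb{Q}$ by $\sigma(0)=1$, $\sigma(q)=0$ if $q\in\mathbb{Q}\setminus\mathbb{N}_0$, and $\sigma(q)=\sum_{d\mid q} d$ for $q\in\mathbb{N}=\{1,2,\dots\}$. *)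

theory Defs
  imports Complex_Main
begin

definition tri_reps :: "nat \<Rightarrow> nat \<Rightarrow> nat list set" where
  "tri_reps k n = {xs. length xs = k \<and> n = (\<Sum>x\<leftarrow>xs. x * (x + 1) div 2)}"

definition t :: "nat \<Rightarrow> nat \<Rightarrow> nat" where
  "t k n = card (tri_reps k n)"

text \<open>The set counted is finite, so \<open>card\<close> is the true number of representations.\<close>

lemma finite_tri_reps: "finite (tri_reps k n)"
proof (rule finite_subset)
  show "tri_reps k n \<subseteq> {xs. set xs \<subseteq> {..n} \<and> length xs = k}"
  proof
    fix xs assume xs: "xs \<in> tri_reps k n"
    have "x \<le> n" if "x \<in> set xs" for x
    proof -
      have "x * (x + 1) div 2 \<le> n"
        using xs that member_le_sum_list[of "x * (x + 1) div 2" "map (\<lambda>x. x * (x + 1) div 2) xs"]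
        by (auto simp: tri_reps_def)
      moreover have "x \<le> x * (x + 1) div 2"
        by (cases x) auto
      ultimately show ?thesis by linarith
    qed
    then show "xs \<in> {xs. set xs \<subseteq> {..n} \<and> length xs = k}"
      using xs by (auto simp: tri_reps_def)
  qed
  show "finite {xs. set xs \<subseteq> {..n} \<and> length xs = k}"
    by (rule finite_lists_length_eq) simp
qed

text \<open>The sum-of-divisors function on the rationals, with value 1 at 0 and
  value 0 off the natural numbers. For \<open>q \<in> \<nat>\<close>, \<open>nat \<lfloor>q\<rfloor>\<close> is \<open>q\<close> itself as a \<open>nat\<close>.
  Values are integers because they are subtracted.\<close>

definition sigma :: "rat \<Rightarrow> int" where
  "sigma q = (if q = 0 then 1 else if q \<in> \<nat> then (\<Sum>d | d dvd nat \<lfloor>q\<rfloor>. int d) else 0)"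

end

theory Submission
  imports Defs "HOL-Computational_Algebra.Formal_Power_Series"
begin

unbundle fps_syntax

text \<open>
  Let \<open>\<psi>\<close> be the generating function of the triangular numbers, so that \<open>\<psi> ^ k\<close> generates
  \<open>t k\<close>. Gauss showed that \<open>\<psi>\<close> is the product of the quotients
  \<open>(1 - X ^ (2 * i + 2)) / (1 - X ^ (2 * i + 1))\<close>; the logarithmic derivative of this product is
  the Lambert series whose coefficient at \<open>m\<close> is the sum of \<open>(-1) ^ (d - 1) * d\<close> over the divisors
  \<open>d\<close> of \<open>m\<close>, which is \<open>\<sigma>(m) - 4 * \<sigma>(m / 2)\<close>. Hence \<open>X * (\<psi> ^ k)' = k * \<psi> ^ k * C\<close>, where \<open>C\<close> is
  that series. Gauss's identity is used modulo \<open>X ^ (2 * n + 1)\<close> only, where it follows from a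
  telescoping identity of Shanks for the partial sums of \<open>\<psi>\<close>.
\<close>

section \<open>Finite Gauss products and Shanks's identity\<close>

definition gauss_factor :: "nat \<Rightarrow> 'a :: field fps" where
  "gauss_factor i = (1 - fps_X ^ (2 * i + 2)) * inverse (1 - fps_X ^ (2 * i + 1))"

text \<open>The lower index \<open>s\<close> is kept free because Shanks's identity involves the
  tails of the product; \<open>s = 0\<close> gives the truncated Gauss product itself.\<close>

definition gauss_prod :: "nat \<Rightarrow> nat \<Rightarrow> 'a :: field fps" where
  "gauss_prod s n = (\<Prod>i\<in>{s..<n}. gauss_factor i)"

lemma one_minus_fps_X_power_neq_0: "d > 0 \<Longrightarrow> 1 - fps_X ^ d \<noteq> (0 :: 'a :: field fps)"
  by (metis diff_zero fps_sub_nth fps_X_power_nth fps_one_nth fps_zero_nth less_irrefl zero_neq_one)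

lemma gauss_factor_mult:
  "gauss_factor i * (1 - fps_X ^ (2 * i + 1)) = (1 - fps_X ^ (2 * i + 2) :: 'a :: field fps)"
  by (simp add: gauss_factor_def mult.assoc inverse_mult_eq_1)

lemma gauss_prod_Suc_right: "s \<le> n \<Longrightarrow> gauss_prod s (Suc n) = gauss_prod s n * gauss_factor n"
  by (simp add: gauss_prod_def)

lemma gauss_prod_Suc_left: "s < n \<Longrightarrow> gauss_prod s n = gauss_factor s * gauss_prod (Suc s) n"
  by (simp add: gauss_prod_def prod.atLeast_Suc_lessThan)

lemma gauss_prod_self [simp]: "gauss_prod n n = 1"
  by (simp add: gauss_prod_def)

text \<open>Compares the Shanks sums for \<open>n + 1\<close> and \<open>n\<close> term by term. The
  factor \<open>u\<close> clears the denominator of \<open>gauss_factor n\<close>, and each summand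
  is then the difference of the right-hand side at \<open>s + 1\<close> and at \<open>s\<close>; at
  0 the right-hand side vanishes.\<close>

lemma shanks_telescope:
  fixes n m :: nat
  assumes "m \<le> n"
  defines "u \<equiv> (1 - fps_X ^ (2 * n + 1) :: 'a :: field fps)"
  shows "(\<Sum>s<m. gauss_prod s (Suc n) * fps_X ^ (s * (2 * n + 3)) * u
           - gauss_prod s n * fps_X ^ (s * (2 * n + 1)) * u)
         = gauss_prod m n * fps_X ^ (m * (2 * n + 1)) * (1 - fps_X ^ (2 * m))"
  using \<open>m \<le> n\<close>
proof (induction m)
  case 0
  then show ?case by simp
next
  case (Suc m)
  let ?Q = "gauss_prod (Suc m) n :: 'a fps" and ?r = "gauss_factor m :: 'a fps"
  have P: "gauss_prod m n = ?r * ?Q"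
    using Suc.prems by (intro gauss_prod_Suc_left) simp
  have S: "gauss_prod m (Suc n) * u = gauss_prod m n * (1 - fps_X ^ (2 * n + 2))"
    using Suc.prems
    by (simp add: gauss_prod_Suc_right mult.assoc u_def gauss_factor_mult[simplified])
  define w :: "'a fps" where "w = fps_X ^ (m * (2 * n + 1))"
  define a :: "'a fps" where "a = fps_X ^ (2 * m)"
  define b :: "'a fps" where "b = fps_X ^ (2 * n + 1)"
  have e1: "fps_X ^ (m * (2 * n + 3)) = w * a"
    unfolding w_def a_def by (simp flip: power_add add: algebra_simps)
  have e2: "fps_X ^ (Suc m * (2 * n + 1)) = w * b"
    unfolding w_def b_def by (simp flip: power_add add: algebra_simps)
  have R: "?r * (1 - fps_X * a) = 1 - fps_X ^ (2 * Suc m)"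
    using gauss_factor_mult[of m, where 'a = 'a] by (simp add: a_def)
  have IH: "(\<Sum>s<m. gauss_prod s (Suc n) * fps_X ^ (s * (2 * n + 3)) * u
      - gauss_prod s n * fps_X ^ (s * (2 * n + 1)) * u) = gauss_prod m n * w * (1 - a)"
    unfolding w_def a_def using Suc by simp
  have "(\<Sum>s<Suc m. gauss_prod s (Suc n) * fps_X ^ (s * (2 * n + 3)) * u
           - gauss_prod s n * fps_X ^ (s * (2 * n + 1)) * u)
      = gauss_prod m n * w * (1 - a)
        + ((gauss_prod m (Suc n) * u) * (w * a) - gauss_prod m n * w * u)"
    unfolding sum.lessThan_Suc IH e1 w_def[symmetric] by (simp only: mult_ac)
  \<comment> \<open>With \<open>?r * ?Q * w\<close> factored out, the bracket
    \<open>(1 - a) + a * (1 - X * b) - (1 - b)\<close> collapses to \<open>b * (1 - X * a)\<close>,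
    and \<open>1 - X * a\<close> is the denominator of \<open>?r\<close>.\<close>
  also have "\<dots> = ?Q * (w * b) * (?r * (1 - fps_X * a))"
    unfolding S P by (simp add: u_def b_def algebra_simps)
  finally show ?case
    unfolding R e2 .
qed

text \<open>Passing from \<open>n\<close> to \<open>n + 1\<close> adds to the left side exactly the
  two powers whose exponents are the triangular numbers of index \<open>2 * n\<close> and
  \<open>2 * n + 1\<close>. This is checked after multiplication by the nonzero
  \<open>u\<close>.\<close>

lemma shanks:
  "(\<Sum>s<n. gauss_prod s n * fps_X ^ (s * (2 * n + 1)))
    = (\<Sum>s<2 * n. fps_X ^ (s * (s + 1) div 2) :: 'a :: field fps)"
proof (induction n)
  case 0
  then show ?case by simp
next
  case (Suc n)
  define u :: "'a fps" where "u = 1 - fps_X ^ (2 * n + 1)"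
  define A :: "'a fps" where "A = (\<Sum>s<n. gauss_prod s (Suc n) * fps_X ^ (s * (2 * n + 3)))"
  define B :: "'a fps" where "B = (\<Sum>s<n. gauss_prod s n * fps_X ^ (s * (2 * n + 1)))"
  have "u \<noteq> 0"
    unfolding u_def by (rule one_minus_fps_X_power_neq_0) simp
  \<comment> \<open>The telescoped sum over all \<open>s < n\<close>, where the remaining product
    \<open>gauss_prod n n\<close> is 1.\<close>
  have AB: "A * u - B * u = fps_X ^ (n * (2 * n + 1)) * (1 - fps_X ^ (2 * n))"
    using shanks_telescope[of n n, where 'a = 'a]
    by (simp add: A_def B_def u_def sum_subtractf sum_distrib_right)
  have "(A + gauss_factor n * fps_X ^ (n * (2 * n + 3))) * u
      = A * u + fps_X ^ (n * (2 * n + 3)) * (gauss_factor n * u)"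
    by (simp only: algebra_simps)
  also have "gauss_factor n * u = 1 - fps_X ^ (2 * n + 2)"
    unfolding u_def by (rule gauss_factor_mult)
  also have "A * u + fps_X ^ (n * (2 * n + 3)) * (1 - fps_X ^ (2 * n + 2))
      = (B + fps_X ^ (n * (2 * n + 1)) + fps_X ^ ((n + 1) * (2 * n + 1))) * u"
    using AB by (simp add: u_def algebra_simps flip: power_add power_Suc)
  finally have *: "A + gauss_factor n * fps_X ^ (n * (2 * n + 3))
      = B + fps_X ^ (n * (2 * n + 1)) + fps_X ^ ((n + 1) * (2 * n + 1))"
    using \<open>u \<noteq> 0\<close> by simp
  have tri: "2 * n * (2 * n + 1) div 2 = n * (2 * n + 1)"
    "Suc (2 * n) * (Suc (2 * n) + 1) div 2 = (n + 1) * (2 * n + 1)"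
    using nonzero_mult_div_cancel_left[of 2 "(n + 1) * (2 * n + 1)"]
    by (simp_all add: algebra_simps)
  have "(\<Sum>s<Suc n. gauss_prod s (Suc n) * fps_X ^ (s * (2 * n + 3)))
      = A + gauss_factor n * fps_X ^ (n * (2 * n + 3))"
    by (simp add: A_def gauss_prod_Suc_right)
  moreover have "\<dots> = (\<Sum>s<Suc (Suc (2 * n)). fps_X ^ (s * (s + 1) div 2))"
    unfolding * sum.lessThan_Suc tri B_def Suc.IH ..
  moreover have "2 * Suc n + 1 = 2 * n + 3" "2 * Suc n = Suc (Suc (2 * n))"
    by simp_all
  ultimately show ?case
    by (simp only:)
qed

definition tri_fps :: "'a :: field fps" where
  "tri_fps = Abs_fps (\<lambda>n. of_nat (card {x :: nat. x * (x + 1) div 2 = n}))"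

lemma le_triangular: "x \<le> x * (x + 1) div 2" for x :: nat
  by (cases x) auto

text \<open>In Shanks's identity the terms with \<open>s > 0\<close> are divisible by
  \<open>X ^ (2 * n + 1)\<close>, so up to degree \<open>2 * n\<close> only the full product
  \<open>gauss_prod 0 n\<close> contributes.\<close>

lemma tri_fps_nth_eq_gauss_prod:
  assumes "n > 0" "j \<le> 2 * n"
  shows "tri_fps $ j = (gauss_prod 0 n $ j :: 'a :: field)"
proof -
  \<comment> \<open>The first triangular number missing from Shanks's sum is
    \<open>n * (2 * n + 1)\<close>, which exceeds \<open>2 * n\<close> because
    \<open>n > 0\<close>.\<close>
  have "2 * n * (2 * n + 1) div 2 > j"
    using assms by (cases n) auto
  then have "x < 2 * n" if "x * (x + 1) div 2 = j" for x
    using that mult_le_mono[of "2 * n" x "2 * n + 1" "x + 1"]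
    by (metis add_le_mono1 div_le_mono leD leI)
  then have "{x. x * (x + 1) div 2 = j} = {x \<in> {..<2 * n}. j = x * (x + 1) div 2}"
    by auto
  then have "tri_fps $ j = (\<Sum>s<2 * n. fps_X ^ (s * (s + 1) div 2) :: 'a fps) $ j"
    by (simp add: tri_fps_def fps_sum_nth fps_X_power_nth sum.If_cases Int_def)
  also have "\<dots> = (\<Sum>s<n. (gauss_prod s n * fps_X ^ (s * (2 * n + 1))) $ j)"
    unfolding shanks[symmetric] fps_sum_nth ..
  also have "\<dots> = (\<Sum>s<n. if s = 0 then gauss_prod 0 n $ j else 0)"
  proof (intro sum.cong refl)
    fix s
    have "j < s * (2 * n + 1)" if "s > 0"
      using that assms by (cases s) auto
    then show "(gauss_prod s n * fps_X ^ (s * (2 * n + 1))) $ j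
        = (if s = 0 then gauss_prod 0 n $ j else 0 :: 'a)"
      by (auto simp: fps_X_power_mult_right_nth)
  qed
  also have "\<dots> = gauss_prod 0 n $ j"
    using assms by simp
  finally show ?thesis .
qed

section \<open>Lambert series and logarithmic derivatives\<close>

definition lambert :: "nat \<Rightarrow> 'a :: field fps" where
  "lambert d = Abs_fps (\<lambda>n. if n > 0 \<and> d dvd n then of_nat d else 0)"

text \<open>A geometric series: \<open>lambert d\<close> expands
  \<open>d * X ^ d / (1 - X ^ d)\<close>. Its coefficient at 0 has to be excluded explicitly, since
  \<open>d dvd 0\<close>.\<close>

lemma lambert_mult: "d > 0 \<Longrightarrow> lambert d * (1 - fps_X ^ d) = of_nat d * fps_X ^ d"
  by (intro fps_ext)
     (auto simp: lambert_def algebra_simps fps_X_power_mult_right_nth fps_X_power_mult_nth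
        dvd_diff_nat dest: dvd_imp_le dvd_diffD)

lemma fps_X_deriv_one_minus_power:
  "d > 0 \<Longrightarrow> fps_X * fps_deriv (1 - fps_X ^ d) = - (lambert d * (1 - fps_X ^ d))"
  by (intro fps_ext) (simp add: lambert_mult)

text \<open>The product rule is applied to \<open>?r * ?u = ?v\<close>, which avoids differentiating
  an inverse; the nonzero \<open>?u\<close> is cancelled at the end.\<close>

lemma fps_X_deriv_gauss_factor:
  "fps_X * fps_deriv (gauss_factor i)
    = gauss_factor i * (lambert (2 * i + 1) - lambert (2 * i + 2) :: 'a :: field fps)"
proof -
  let ?u = "1 - fps_X ^ (2 * i + 1) :: 'a fps" and ?v = "1 - fps_X ^ (2 * i + 2) :: 'a fps"
  let ?r = "gauss_factor i :: 'a fps"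
  have "?u \<noteq> 0"
    by (rule one_minus_fps_X_power_neq_0) simp
  have rv: "?r * ?u = ?v"
    by (rule gauss_factor_mult)
  have du: "fps_X * fps_deriv ?u = - (lambert (2 * i + 1) * ?u)"
    by (rule fps_X_deriv_one_minus_power) simp
  have dv: "fps_X * fps_deriv ?v = - (lambert (2 * i + 2) * ?v)"
    by (rule fps_X_deriv_one_minus_power) simp
  have "fps_X * fps_deriv ?v = fps_X * fps_deriv ?r * ?u + ?r * (fps_X * fps_deriv ?u)"
    unfolding rv[symmetric] fps_deriv_mult by (simp only: algebra_simps)
  then have "fps_X * fps_deriv ?r * ?u
      = - (lambert (2 * i + 2) * (?r * ?u)) + ?r * (lambert (2 * i + 1) * ?u)"
    unfolding du dv rv by (simp only: mult_minus_right add_uminus_conv_diff diff_add_cancel)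
  moreover have "- (b * (r * w)) + r * (a * w) = r * (a - b) * w" for a b r w :: "'a fps"
    by (simp add: algebra_simps)
  ultimately have "fps_X * fps_deriv ?r * ?u
      = ?r * (lambert (2 * i + 1) - lambert (2 * i + 2)) * ?u"
    by (simp only:)
  then show ?thesis
    using \<open>?u \<noteq> 0\<close> by (metis mult_cancel_right)
qed

lemma fps_X_deriv_gauss_prod:
  "fps_X * fps_deriv (gauss_prod 0 n)
    = gauss_prod 0 n * (\<Sum>i<n. lambert (2 * i + 1) - lambert (2 * i + 2) :: 'a :: field fps)"
proof (induction n)
  case (Suc n)
  have "fps_X * fps_deriv (gauss_prod 0 (Suc n)) =
      fps_X * fps_deriv (gauss_prod 0 n) * gauss_factor n
      + gauss_prod 0 n * (fps_X * fps_deriv (gauss_factor n) :: 'a fps)"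
    by (simp add: gauss_prod_Suc_right algebra_simps)
  then show ?case
    unfolding Suc.IH fps_X_deriv_gauss_factor by (simp add: gauss_prod_Suc_right algebra_simps)
qed simp

definition alt_sigma :: "nat \<Rightarrow> int" where
  "alt_sigma m = (\<Sum>d | d dvd m \<and> odd d. int d) - (\<Sum>d | d dvd m \<and> even d. int d)"

lemma lambert_sum_nth:
  assumes "j \<le> 2 * n"
  shows "(\<Sum>i<n. lambert (2 * i + 1) - lambert (2 * i + 2)) $ j
    = (if j = 0 then 0 else of_int (alt_sigma j) :: 'a :: field)"
proof (cases "j = 0")
  case False
  then have j: "j > 0"
    by simp
  \<comment> \<open>Hence the odd numbers \<open>2 * i + 1\<close> and the even numbers
    \<open>2 * i + 2\<close> with \<open>i < n\<close> already cover all divisors of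
    \<open>j\<close>.\<close>
  have le: "d \<le> 2 * n" if "d dvd j" for d
    using dvd_imp_le[OF that j] assms by linarith
  have "(\<Sum>d | d dvd j \<and> odd d. of_nat d) =
      (\<Sum>i<n. if 2 * i + 1 dvd j then of_nat (2 * i + 1) else (0 :: 'a))"
    unfolding sum.If_cases[OF finite_lessThan] sum.neutral_const add_0_right
  proof (rule sum.reindex_bij_witness[where i = "\<lambda>i. 2 * i + 1" and j = "\<lambda>d. d div 2"])
    fix d assume "d \<in> {d. d dvd j \<and> odd d}"
    then show "d div 2 \<in> {..<n} \<inter> {i. 2 * i + 1 dvd j}"
      using le[of d] by (auto elim!: oddE)
  qed auto
  moreover have "(\<Sum>d | d dvd j \<and> even d. of_nat d) =
      (\<Sum>i<n. if 2 * i + 2 dvd j then of_nat (2 * i + 2) else (0 :: 'a))"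
    unfolding sum.If_cases[OF finite_lessThan] sum.neutral_const add_0_right
  proof (rule sum.reindex_bij_witness[where i = "\<lambda>i. 2 * i + 2" and j = "\<lambda>d. d div 2 - 1"])
    fix d assume d: "d \<in> {d. d dvd j \<and> even d}"
    then have "d > 0"
      using j by (auto intro!: Nat.gr0I)
    with d obtain e where e: "d = 2 * Suc e"
      by (metis (mono_tags) dvdE mem_Collect_eq mult_0_right not0_implies_Suc not_less_zero)
    show "d div 2 - 1 \<in> {..<n} \<inter> {i. 2 * i + 2 dvd j}" "2 * (d div 2 - 1) + 2 = d"
      "of_nat (2 * (d div 2 - 1) + 2) = (of_nat d :: 'a)"
      using d le[of d] by (auto simp: e)
  qed auto
  ultimately show ?thesis
    using j by (simp add: fps_sum_nth lambert_def alt_sigma_def sum_subtractf cong: if_cong)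
qed (simp add: fps_sum_nth lambert_def)

definition lambert_fps :: "'a :: field fps" where
  "lambert_fps = Abs_fps (\<lambda>j. if j = 0 then 0 else of_int (alt_sigma j))"

text \<open>The coefficient at \<open>m\<close> of either side involves only coefficients up to
  \<open>m\<close>, where \<open>tri_fps\<close> agrees with a finite Gauss product whose
  logarithmic derivative is known.\<close>

lemma fps_X_deriv_tri_fps: "fps_X * fps_deriv tri_fps = tri_fps * (lambert_fps :: 'a :: field fps)"
proof (rule fps_ext)
  fix m
  \<comment> \<open>Ensures both \<open>n > 0\<close> and \<open>m \<le> 2 * n\<close>, even for
    \<open>m = 0\<close>.\<close>
  define n where "n = Suc m"
  define L :: "'a fps" where "L = (\<Sum>i<n. lambert (2 * i + 1) - lambert (2 * i + 2))"
  have tri: "tri_fps $ j = (gauss_prod 0 n $ j :: 'a)" if "j \<le> m" for j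
    using that by (intro tri_fps_nth_eq_gauss_prod) (simp_all add: n_def)
  have L: "L $ j = lambert_fps $ j" if "j \<le> m" for j
    using that lambert_sum_nth[of j n, where 'a = 'a] by (simp add: L_def lambert_fps_def n_def)
  have "(fps_X * fps_deriv tri_fps) $ m = (fps_X * fps_deriv (gauss_prod 0 n :: 'a fps)) $ m"
    using tri[of m] by (simp add: fps_X_mult_nth)
  also have "\<dots> = (gauss_prod 0 n * L) $ m"
    unfolding L_def fps_X_deriv_gauss_prod ..
  also have "\<dots> = (tri_fps * lambert_fps) $ m"
    unfolding fps_mult_nth by (intro sum.cong refl) (simp add: tri L)
  finally show "(fps_X * fps_deriv tri_fps) $ m = (tri_fps * lambert_fps :: 'a fps) $ m" .
qed

lemma fps_X_deriv_tri_fps_power: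
  "fps_X * fps_deriv (tri_fps ^ k) = of_nat k * (tri_fps ^ k * (lambert_fps :: 'a :: field fps))"
proof (cases k)
  case (Suc l)
  have "fps_X * fps_deriv (tri_fps ^ k)
      = of_nat k * tri_fps ^ l * (fps_X * fps_deriv tri_fps :: 'a fps)"
    unfolding fps_deriv_power' by (simp add: Suc mult_ac)
  then show ?thesis
    unfolding fps_X_deriv_tri_fps by (simp add: Suc algebra_simps)
qed simp

section \<open>Representation counts as coefficients of powers\<close>

lemma t_0: "t 0 n = (if n = 0 then 1 else 0)"
proof -
  have "tri_reps 0 n = (if n = 0 then {[]} else {})"
    by (auto simp: tri_reps_def)
  then show ?thesis
    by (simp add: t_def)
qed

text \<open>Lists are split by the triangular number \<open>i\<close> of their head. This is the
  Cauchy product behind \<open>tri_fps_power_nth\<close>.\<close>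

lemma t_Suc: "t (Suc k) n = (\<Sum>i\<le>n. card {x. x * (x + 1) div 2 = i} * t k (n - i))"
proof -
  let ?A = "\<lambda>i. {x. x * (x + 1) div 2 = i} \<times> tri_reps k (n - i)"
  have fin: "finite {x :: nat. x * (x + 1) div 2 = i}" for i
    by (rule finite_subset[of _ "{..i}"]) (use le_triangular in auto)
  have "tri_reps (Suc k) n = (\<lambda>(x, xs). x # xs) ` (\<Union>i\<le>n. ?A i)"
    by (force simp: tri_reps_def length_Suc_conv image_iff)
  then have "t (Suc k) n = card (\<Union>i\<le>n. ?A i)"
    unfolding t_def by (simp add: card_image inj_on_def split_beta prod_eq_iff)
  \<comment> \<open>The sets are disjoint because the first component determines
    \<open>i\<close>.\<close>
  also have "\<dots> = (\<Sum>i\<le>n. card (?A i))"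
    using fin by (intro card_UN_disjoint) (auto simp: finite_tri_reps)
  finally show ?thesis
    by (simp add: t_def card_cartesian_product)
qed

lemma tri_fps_power_nth: "(tri_fps ^ k) $ n = (of_nat (t k n) :: 'a :: field)"
proof (induction k arbitrary: n)
  case 0
  then show ?case by (simp add: t_0)
next
  case (Suc k)
  then show ?case
    by (simp add: t_Suc fps_mult_nth tri_fps_def atMost_atLeast0)
qed

section \<open>Divisor sums and the recurrence\<close>

lemma sigma_of_nat: "m > 0 \<Longrightarrow> sigma (of_nat m) = (\<Sum>d | d dvd m. int d)"
  by (simp add: sigma_def)

text \<open>Doubling maps the divisors of \<open>m / 2\<close> onto the even divisors of
  \<open>m\<close>. For odd \<open>m\<close> both sides are 0, as \<open>m / 2\<close> is not a
  natural number.\<close>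

lemma sigma_half:
  assumes "m > 0"
  shows "2 * sigma (of_nat m / 2) = (\<Sum>d | d dvd m \<and> even d. int d)"
proof (cases "even m")
  case True
  then obtain l where l: "m = 2 * l"
    by blast
  have "2 * sigma (of_nat m / 2) = 2 * (\<Sum>d | d dvd l. int d)"
    using assms by (simp add: l sigma_of_nat)
  also have "\<dots> = (\<Sum>d | d dvd m \<and> even d. int d)"
    unfolding sum_distrib_left
    by (rule sum.reindex_bij_witness[where i = "\<lambda>d. d div 2" and j = "\<lambda>d. 2 * d"])
       (auto simp: l)
  finally show ?thesis .
next
  case False
  have "of_nat m / 2 \<notin> (\<nat> :: rat set)"
  proof
    assume "of_nat m / 2 \<in> (\<nat> :: rat set)"
    then obtain l where "(of_nat m :: rat) / 2 = of_nat l"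
      by (auto elim: Nats_cases)
    then have "(of_nat m :: rat) = of_nat (2 * l)"
      by simp
    then show False
      using False by (metis dvd_triv_left of_nat_eq_iff)
  qed
  then have "sigma (of_nat m / 2) = 0"
    using assms by (auto simp: sigma_def)
  moreover have no_even: "{d. d dvd m \<and> even d} = {}"
    using False dvd_trans by blast
  ultimately show ?thesis
    unfolding no_even by simp
qed

text \<open>By \<open>sigma_half\<close> the subtracted term is twice the sum of the even divisors,
  which turns their sign from plus to minus.\<close>

lemma sigma_minus_4_sigma_half:
  assumes "m > 0"
  shows "sigma (of_nat m) - 4 * sigma (of_nat m / 2) = alt_sigma m"
proof -
  have "finite {d. d dvd m}"
    using assms by simp
  then have "(\<Sum>d | d dvd m. int d)
      = (\<Sum>d | d dvd m \<and> odd d. int d) + (\<Sum>d | d dvd m \<and> even d. int d)"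
    by (subst sum.union_disjoint[symmetric]) (auto intro!: sum.cong)
  then show ?thesis
    using sigma_half[OF assms] by (simp add: sigma_of_nat assms alt_sigma_def)
qed

theorem theorem2p4:
  fixes k n :: nat
  shows "int n * int (t k n) =
    int k * (\<Sum>j = 0..<n. int (t k j) *
      (sigma (of_nat n - of_nat j) - 4 * sigma ((of_nat n - of_nat j) / 2)))"
proof -
  \<comment> \<open>The computation moves to the rationals because the power series lemmas are
    stated over a field; it returns to the integers by injectivity of \<open>of_int\<close>.\<close>
  have "(of_int (int n * int (t k n)) :: rat) = (fps_X * fps_deriv (tri_fps ^ k)) $ n"
    by (cases n) (simp_all add: tri_fps_power_nth)
  also have "\<dots> = of_nat k * (\<Sum>j = 0..n. of_nat (t k j) * lambert_fps $ (n - j))"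
    unfolding fps_X_deriv_tri_fps_power
    unfolding fps_mult_of_nat_nth unfolding fps_mult_nth tri_fps_power_nth ..
  \<comment> \<open>The term \<open>j = n\<close> drops out because \<open>lambert_fps\<close> has
    constant coefficient 0.\<close>
  also have "(\<Sum>j = 0..n. of_nat (t k j) * lambert_fps $ (n - j) :: rat)
      = (\<Sum>j = 0..<n. of_nat (t k j) * of_int (alt_sigma (n - j)))"
    by (rule sum.mono_neutral_cong_right) (auto simp: lambert_fps_def)
  finally have "int n * int (t k n) = int k * (\<Sum>j = 0..<n. int (t k j) * alt_sigma (n - j))"
    by (simp flip: of_int_eq_iff[where 'a = rat])
  also have "(\<Sum>j = 0..<n. int (t k j) * alt_sigma (n - j)) = (\<Sum>j = 0..<n. int (t k j) *
      (sigma (of_nat n - of_nat j) - 4 * sigma ((of_nat n - of_nat j) / 2)))"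
  proof (intro sum.cong refl)
    fix j assume "j \<in> {0..<n}"
    then show "int (t k j) * alt_sigma (n - j) = int (t k j) *
        (sigma (of_nat n - of_nat j) - 4 * sigma ((of_nat n - of_nat j) / 2))"
      using sigma_minus_4_sigma_half[of "n - j"] by (simp add: of_nat_diff)
  qed
  finally show ?thesis .
qed

end
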